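(* Let $\hat\rho>0$, $\mathbf{v}\in\mathbb{R}^d$, and let $\mathbf{z}^*$ denote the optimal solution of $$\min_{\mathbf{z}\in\mathbb{R}^d}\ \frac12\|\mathbf{z}-\mathbf{v}\|^2+\frac{\hat\rho}{2}\|\mathbf{z}\|_1^2 .$$ If $\mathbf{v}=0$, then $\mathbf{z}^*=0$. Otherwise, suppose $\mathbf{v}\ne0$ and let $i_1,\dots,i_d$ be a permutation of $\{1,\dots,d\}$ such that $|\mathbf{v}_{i_1}|\le|\mathbf{v}_{i_2}|\le\dots\le|\mathbf{v}_{i_d}|$. Introduce a dummy index $i_0=0$ and a dummy scalar $\mathbf{v}_{i_0}=0$, and let $$s_k=\sum_{t=0}^{k-1}|\mathbf{v}_{i_t}|+\frac{(d-k+1)\hat\rho+1}{\hat\rho}|\mathbf{v}_{i_k}|,\qquad k=0,\dots,d,$$ with the convention $\sum_{t=0}^{-1}|\mathbf{v}_{i_t}|=0$. Then $s_k$ is non-decreasing in $k$ and $\|\mathbf{v}\|_1<s_d$. Moreover, if $\bar k$ satisfies $s_{\bar k}\le\|\mathbf{v}\|_1<s_{\bar k+1}$, then $$\mathbf{z}^*_{i_t}=\begin{cases}0&\text{if }1\le t\le\bar k,\\[2pt]\mathbf{v}_{i_t}-\dfrac{\mathrm{sgn}(\mathbf{v}_{i_t})\,\hat\rho}{\hat\rho(d-\bar k)+1}\displaystyle\sum_{l=\bar k+1}^d|\mathbf{v}_{i_l}|&\text{if }t>\bar k.\end{cases}$$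
   Context: $\|\cdot\|$ is the Euclidean norm, $\|\cdot\|_1$ the $\ell_1$-norm, $\mathbf{v}_i$ the $i$-th component of $\mathbf{v}$, and $\mathrm{sgn}$ the sign function. *)

theory Defs
  imports "HOL-Analysis.Analysis"
begin

definition l1_norm :: "real ^ 'n \<Rightarrow> real" where
  "l1_norm x = (\<Sum>j\<in>UNIV. \<bar>x $ j\<bar>)"

definition l1sq_objective :: "real \<Rightarrow> real ^ 'n \<Rightarrow> real ^ 'n \<Rightarrow> real" where
  "l1sq_objective \<rho> v z = 1 / 2 * (norm (z - v))\<^sup>2 + \<rho> / 2 * (l1_norm z)\<^sup>2"

definition is_l1sq_solution :: "real \<Rightarrow> real ^ 'n \<Rightarrow> real ^ 'n \<Rightarrow> bool" where
  "is_l1sq_solution \<rho> v z \<longleftrightarrow> is_arg_min (l1sq_objective \<rho> v) (\<lambda>_. True) z"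

(* Coordinates are indexed by the type 'n, so a permutation of {1..d} is represented by an
   enumeration of 'n by {1..d}, where d = CARD('n); i 0 is irrelevant. *)
definition abs_sorting_enum :: "real ^ 'n \<Rightarrow> (nat \<Rightarrow> 'n) \<Rightarrow> bool" where
  "abs_sorting_enum v i \<longleftrightarrow>
     bij_betw i {1..CARD('n)} UNIV \<and> mono_on {1..CARD('n)} (\<lambda>t. \<bar>v $ i t\<bar>)"

(* Position 0 is the dummy index, carrying the dummy scalar 0. *)
definition enum_entry :: "real ^ 'n \<Rightarrow> (nat \<Rightarrow> 'n) \<Rightarrow> nat \<Rightarrow> real" where
  "enum_entry v i t = (if t = 0 then 0 else v $ i t)"

(* Meaningful for k <= CARD('n) only. *)
definition threshold_seq :: "real \<Rightarrow> real ^ 'n \<Rightarrow> (nat \<Rightarrow> 'n) \<Rightarrow> nat \<Rightarrow> real" where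
  "threshold_seq \<rho> v i k =
     (\<Sum>t<k. \<bar>enum_entry v i t\<bar>)
     + ((real CARD('n) - real k + 1) * \<rho> + 1) / \<rho> * \<bar>enum_entry v i k\<bar>"

end

theory Submission
  imports Defs
begin

text \<open>The objective is \<open>1\<close>-strongly convex, and \<open>z\<close> minimises it exactly when \<open>v - z\<close> is a
  subgradient of \<open>\<rho> / 2 * (l1_norm z)\<^sup>2\<close>, that is \<open>\<rho> * l1_norm z\<close> times a subgradient of the
  \<open>\<ell>\<^sub>1\<close>-norm. Hence \<open>z\<close> is the soft thresholding of \<open>v\<close> at the level \<open>c = \<rho> * l1_norm z\<close>, and the
  problem reduces to the scalar fixed-point equation
  \<open>c = \<rho> * (\<Sum>j\<in>UNIV. max (\<bar>v $ j\<bar> - c) 0)\<close>. Only one direction of this is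
  used: the vector \<open>z\<close> thresholded at a fixed point has an objective value below that of every \<open>w\<close>
  by at least \<open>1 / 2 * (norm (w - z))\<^sup>2\<close> (\<open>l1sq_objective_quadratic_growth\<close>), so that it is the
  unique minimiser.
  A fixed point exists by the intermediate value theorem (\<open>threshold_level_exists\<close>).

  If exactly the entries at positions beyond \<open>k\<close> of the sorted order survive the thresholding, the
  fixed-point equation is linear and yields
  \<open>c = \<rho> / (\<rho> * (d - k) + 1) * (\<Sum>l=k+1..d. \<bar>v $ i l\<bar>)\<close>. After cancelling the common part of
  the sums, the inequalities \<open>s\<^sub>k \<le> \<parallel>v\<parallel>\<^sub>1 < s\<^sub>k\<^sub>+\<^sub>1\<close> say that the \<open>k\<close>-th sorted absolute value is at
  most this \<open>c\<close> and the next one exceeds it (\<open>sorted_level_separates\<close>), which is what makes this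
  guess for the surviving entries consistent (\<open>sorted_level_is_fixed_point\<close>).\<close>

section \<open>Scalar soft thresholding\<close>

definition soft_threshold :: "real \<Rightarrow> real \<Rightarrow> real" where
  "soft_threshold c x = sgn x * max (\<bar>x\<bar> - c) 0"

lemma abs_soft_threshold:
  assumes "c \<ge> 0"
  shows "\<bar>soft_threshold c x\<bar> = max (\<bar>x\<bar> - c) 0"
  using assms by (auto simp: soft_threshold_def abs_mult sgn_real_def)

lemma soft_threshold_above: "c \<le> \<bar>x\<bar> \<Longrightarrow> soft_threshold c x = x - sgn x * c"
  by (auto simp: soft_threshold_def sgn_real_def)

lemma soft_threshold_below: "\<bar>x\<bar> \<le> c \<Longrightarrow> soft_threshold c x = 0"
  by (simp add: soft_threshold_def max_def)

text \<open>This is the optimality condition of the scalar problem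
  \<open>1 / 2 * (w - x)\<^sup>2 + c * \<bar>w\<bar>\<close> at its minimiser \<open>soft_threshold c x\<close>, in the form of a
  variational inequality.\<close>

lemma soft_threshold_variational:
  fixes c x w :: real
  assumes "c \<ge> 0"
  defines "p \<equiv> soft_threshold c x"
  shows "(p - x) * (w - p) + c * (\<bar>w\<bar> - \<bar>p\<bar>) \<ge> 0"
proof (cases "\<bar>x\<bar> \<le> c")
  case True
  have "x * w \<le> \<bar>x\<bar> * \<bar>w\<bar>"
    by (metis abs_ge_self abs_mult)
  also have "\<dots> \<le> c * \<bar>w\<bar>"
    using True by (simp add: mult_right_mono)
  finally show ?thesis
    using True by (simp add: p_def soft_threshold_below)
next
  case False
  have p: "p = x - sgn x * c"
    using False unfolding p_def by (intro soft_threshold_above) simp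
  hence px: "p - x = - (sgn x * c)"
    by simp
  have "\<bar>p\<bar> = sgn x * p"
    using False assms(1) by (auto simp: p sgn_real_def)
  hence "(p - x) * (w - p) + c * (\<bar>w\<bar> - \<bar>p\<bar>) = c * (\<bar>w\<bar> - sgn x * w)"
    unfolding px by (simp add: algebra_simps)
  moreover have "sgn x * w \<le> \<bar>w\<bar>"
    by (auto simp: sgn_real_def)
  ultimately show ?thesis
    using assms(1) by simp
qed

section \<open>Minimisers as soft thresholdings at a fixed point\<close>

definition soft_threshold_vec :: "real \<Rightarrow> real ^ 'n \<Rightarrow> real ^ 'n" where
  "soft_threshold_vec c v = (\<chi> j. soft_threshold c (v $ j))"

lemma l1_norm_soft_threshold_vec:
  assumes "c \<ge> 0"
  shows "l1_norm (soft_threshold_vec c v) = (\<Sum>j\<in>UNIV. max (\<bar>v $ j\<bar> - c) 0)"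
  by (simp add: l1_norm_def soft_threshold_vec_def abs_soft_threshold assms)

text \<open>The square of the \<open>\<ell>\<^sub>1\<close>-norm lies above its tangent,
  \<open>b\<^sup>2 \<ge> a\<^sup>2 + 2 * a * (b - a)\<close>. With \<open>a\<close> the norm of the thresholded vector, the slope of the
  penalty becomes \<open>\<rho> * a = c\<close>, and the problem splits into the scalar ones.\<close>

lemma l1sq_objective_quadratic_growth:
  fixes v w :: "real ^ 'n"
  assumes "\<rho> > 0" and c: "c = \<rho> * (\<Sum>j\<in>UNIV. max (\<bar>v $ j\<bar> - c) 0)"
  defines "z \<equiv> soft_threshold_vec c v"
  shows "l1sq_objective \<rho> v w \<ge> l1sq_objective \<rho> v z + 1 / 2 * (norm (w - z))\<^sup>2"
proof -
  have "(\<Sum>j\<in>UNIV. max (\<bar>v $ j\<bar> - c) 0) \<ge> 0"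
    by (intro sum_nonneg) simp
  hence c0: "c \<ge> 0"
    by (subst c) (use assms(1) in simp)
  have cz: "c = \<rho> * l1_norm z"
    using c by (simp add: z_def l1_norm_soft_threshold_vec c0)
  have "0 \<le> (\<Sum>j\<in>UNIV. (z $ j - v $ j) * (w $ j - z $ j) + c * (\<bar>w $ j\<bar> - \<bar>z $ j\<bar>))"
    using soft_threshold_variational[OF c0]
    by (intro sum_nonneg) (simp add: z_def soft_threshold_vec_def)
  also have "\<dots> = inner (z - v) (w - z) + c * (l1_norm w - l1_norm z)"
    by (simp add: sum.distrib inner_vec_def l1_norm_def sum_subtractf flip: sum_distrib_left)
  finally have split: "0 \<le> inner (z - v) (w - z) + c * (l1_norm w - l1_norm z)" .
  have expand: "(norm (w - v))\<^sup>2 = (norm (z - v))\<^sup>2 + 2 * inner (z - v) (w - z) + (norm (w - z))\<^sup>2"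
    by (simp add: power2_norm_eq_inner inner_diff_left inner_diff_right inner_commute)
  have "0 \<le> \<rho> / 2 * (l1_norm w - l1_norm z)\<^sup>2"
    using assms(1) by simp
  also have "\<dots> = \<rho> / 2 * (l1_norm w)\<^sup>2 - \<rho> / 2 * (l1_norm z)\<^sup>2 - c * (l1_norm w - l1_norm z)"
    unfolding cz by (simp add: power2_eq_square field_simps)
  finally show ?thesis
    using split unfolding l1sq_objective_def expand by (simp add: algebra_simps)
qed

lemma is_l1sq_solution_iff_soft_threshold:
  assumes "\<rho> > 0" and "c = \<rho> * (\<Sum>j\<in>UNIV. max (\<bar>v $ j\<bar> - c) 0)"
  shows "is_l1sq_solution \<rho> v w \<longleftrightarrow> w = soft_threshold_vec c v"
proof -
  define z where "z = soft_threshold_vec c v"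
  have growth: "l1sq_objective \<rho> v u \<ge> l1sq_objective \<rho> v z + 1 / 2 * (norm (u - z))\<^sup>2" for u
    unfolding z_def by (rule l1sq_objective_quadratic_growth[OF assms])
  have min: "l1sq_objective \<rho> v z \<le> l1sq_objective \<rho> v u" for u
    using growth[of u] zero_le_power2[of "norm (u - z)"] by linarith
  have "w = z" if "l1sq_objective \<rho> v w \<le> l1sq_objective \<rho> v z"
  proof -
    have "(norm (w - z))\<^sup>2 \<le> 0"
      using growth[of w] that by linarith
    thus ?thesis by simp
  qed
  thus ?thesis
    using min unfolding is_l1sq_solution_def is_arg_min_linorder z_def[symmetric] by blast
qed

lemma threshold_level_exists:
  fixes v :: "real ^ 'n"
  assumes "\<rho> > 0"
  shows "\<exists>c. c = \<rho> * (\<Sum>j\<in>UNIV. max (\<bar>v $ j\<bar> - c) 0)"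
proof -
  define f where "f = (\<lambda>c. c - \<rho> * (\<Sum>j\<in>UNIV. max (\<bar>v $ j\<bar> - c) 0))"
  have l1: "l1_norm v \<ge> 0"
    by (simp add: l1_norm_def sum_nonneg)
  (* b is the value of the fixed-point map at 0; that map is antitone, so at b it is at most b. *)
  define b where "b = \<rho> * l1_norm v"
  have b: "b \<ge> 0"
    using assms l1 by (simp add: b_def)
  have "f 0 \<le> 0"
    using b by (simp add: f_def b_def l1_norm_def)
  moreover have "f b \<ge> 0"
  proof -
    have "(\<Sum>j\<in>UNIV. max (\<bar>v $ j\<bar> - b) 0) \<le> l1_norm v"
      unfolding l1_norm_def using b by (intro sum_mono) auto
    thus ?thesis
      using assms by (simp add: f_def b_def)
  qed
  moreover have "continuous_on {0..b} f"
    unfolding f_def by (intro continuous_intros)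
  ultimately obtain c where "f c = 0"
    using IVT'[of f 0 0 b] b by auto
  thus ?thesis
    by (auto simp: f_def)
qed

section \<open>The threshold sequence\<close>

lemma sum_enum_entry: "(\<Sum>t<Suc k. \<bar>enum_entry v i t\<bar>) = (\<Sum>t=1..k. \<bar>v $ i t\<bar>)"
  by (induction k) (simp_all add: enum_entry_def)

text \<open>The partial sum can be taken up to \<open>k - 1\<close> or up to \<open>k\<close>, the last factor absorbing the
  difference. In the first form for \<open>k + 1\<close> and in the second form for \<open>k\<close>, the thresholds differ
  only in the absolute value that is multiplied, which shows their monotonicity and makes them
  comparable with the same split of \<open>l1_norm v\<close>.\<close>

lemma threshold_seq_Suc:
  fixes v :: "real ^ 'n"
  shows "threshold_seq \<rho> v i (Suc k) = (\<Sum>t=1..k. \<bar>v $ i t\<bar>)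
           + ((real CARD('n) - real k) * \<rho> + 1) / \<rho> * \<bar>enum_entry v i (Suc k)\<bar>"
  unfolding threshold_seq_def sum_enum_entry by simp

lemma threshold_seq_inclusive:
  fixes v :: "real ^ 'n"
  assumes "\<rho> > 0"
  shows "threshold_seq \<rho> v i k = (\<Sum>t=1..k. \<bar>v $ i t\<bar>)
           + ((real CARD('n) - real k) * \<rho> + 1) / \<rho> * \<bar>enum_entry v i k\<bar>"
  unfolding threshold_seq_def sum_enum_entry[symmetric]
  using assms by (simp add: field_simps)

lemma sum_enum:
  fixes v :: "real ^ 'n" and g :: "real \<Rightarrow> real"
  assumes "abs_sorting_enum v i" and "k \<le> CARD('n)"
  shows "(\<Sum>j\<in>UNIV. g (v $ j)) = (\<Sum>t=1..k. g (v $ i t)) + (\<Sum>t=k+1..CARD('n). g (v $ i t))"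
proof -
  have "(\<Sum>j\<in>UNIV. g (v $ j)) = (\<Sum>t=1..CARD('n). g (v $ i t))"
    using assms(1) sum.reindex_bij_betw[of i "{1..CARD('n)}" UNIV "\<lambda>j. g (v $ j)"]
    by (simp add: abs_sorting_enum_def)
  also have "{1..CARD('n)} = {1..k} \<union> {k+1..CARD('n)}"
    using assms(2) by auto
  finally show ?thesis
    by (simp add: sum.union_disjoint)
qed

lemma enum_entry_abs_mono:
  fixes v :: "real ^ 'n"
  assumes "abs_sorting_enum v i" and "s \<le> t" and "t \<le> CARD('n)"
  shows "\<bar>enum_entry v i s\<bar> \<le> \<bar>enum_entry v i t\<bar>"
proof (cases "s = 0")
  case False
  have "mono_on {1..CARD('n)} (\<lambda>t. \<bar>v $ i t\<bar>)"
    using assms(1) by (simp add: abs_sorting_enum_def)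
  from mono_onD[OF this, of s t] show ?thesis
    using False assms(2,3) by (simp add: enum_entry_def)
qed (simp add: enum_entry_def)

lemma threshold_seq_mono:
  fixes v :: "real ^ 'n"
  assumes "\<rho> > 0" and "abs_sorting_enum v i"
  shows "mono_on {0..CARD('n)} (threshold_seq \<rho> v i)"
proof (rule mono_onI)
  fix r s assume "r \<in> {0..CARD('n)}" "s \<in> {0..CARD('n)}" "r \<le> s"
  have "s \<le> CARD('n) \<longrightarrow> threshold_seq \<rho> v i r \<le> threshold_seq \<rho> v i s"
    using \<open>r \<le> s\<close>
  proof (induction s rule: dec_induct)
    case (step k)
    show ?case
    proof
      assume k: "Suc k \<le> CARD('n)"
      have "((real CARD('n) - real k) * \<rho> + 1) / \<rho> \<ge> 0"
        using k assms(1) by simp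
      hence "threshold_seq \<rho> v i k \<le> threshold_seq \<rho> v i (Suc k)"
        unfolding threshold_seq_Suc threshold_seq_inclusive[OF assms(1)]
        using enum_entry_abs_mono[OF assms(2) _ k, of k] by (intro add_left_mono mult_left_mono) simp_all
      thus "threshold_seq \<rho> v i r \<le> threshold_seq \<rho> v i (Suc k)"
        using step.IH k by simp
    qed
  qed simp
  thus "threshold_seq \<rho> v i r \<le> threshold_seq \<rho> v i s"
    using \<open>s \<in> {0..CARD('n)}\<close> by simp
qed

text \<open>The last threshold exceeds \<open>l1_norm v\<close> by \<open>1 / \<rho>\<close> times the largest absolute value, which
  is positive for \<open>v \<noteq> 0\<close>.\<close>

lemma l1_norm_less_last_threshold:
  fixes v :: "real ^ 'n"
  assumes "\<rho> > 0" and "abs_sorting_enum v i" and "v \<noteq> 0"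
  shows "l1_norm v < threshold_seq \<rho> v i CARD('n)"
proof -
  have "l1_norm v = (\<Sum>t=1..CARD('n). \<bar>v $ i t\<bar>)"
    unfolding l1_norm_def using sum_enum[OF assms(2), of "CARD('n)" abs] by simp
  moreover have "\<bar>enum_entry v i CARD('n)\<bar> > 0"
  proof -
    obtain j where j: "v $ j \<noteq> 0"
      using assms(3) by (metis vec_eq_iff zero_index)
    have "i ` {1..CARD('n)} = UNIV"
      using assms(2) by (simp add: abs_sorting_enum_def bij_betw_def)
    then obtain t where t: "t \<in> {1..CARD('n)}" "j = i t"
      by (metis UNIV_I imageE)
    have "\<bar>v $ j\<bar> = \<bar>enum_entry v i t\<bar>"
      using t by (simp add: enum_entry_def)
    also have "\<dots> \<le> \<bar>enum_entry v i CARD('n)\<bar>"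
      using t by (intro enum_entry_abs_mono[OF assms(2)]) simp_all
    finally show ?thesis
      using j by simp
  qed
  ultimately show ?thesis
    unfolding threshold_seq_inclusive[OF assms(1)] using assms(1) by simp
qed

section \<open>The fixed point in sorted order\<close>

text \<open>Cancelling the first \<open>k\<close> absolute values from both sides turns the two hypotheses on the
  thresholds into comparisons of \<open>c\<close> with the entries at positions \<open>k\<close> and \<open>k + 1\<close>; the sorting
  extends them to all positions.\<close>

lemma sorted_level_separates:
  fixes v :: "real ^ 'n"
  assumes "\<rho> > 0" and enum: "abs_sorting_enum v i" and k: "k < CARD('n)"
    and lower: "threshold_seq \<rho> v i k \<le> l1_norm v"
    and upper: "l1_norm v < threshold_seq \<rho> v i (k + 1)"
  defines "c \<equiv> \<rho> / (\<rho> * (real CARD('n) - real k) + 1) * (\<Sum>l=k+1..CARD('n). \<bar>v $ i l\<bar>)"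
  shows "t \<in> {1..k} \<Longrightarrow> \<bar>v $ i t\<bar> \<le> c"
    and "t \<in> {k+1..CARD('n)} \<Longrightarrow> c \<le> \<bar>v $ i t\<bar>"
proof -
  define S where "S = (\<Sum>l=k+1..CARD('n). \<bar>v $ i l\<bar>)"
  define D where "D = \<rho> * (real CARD('n) - real k) + 1"
  have D: "D > 0"
    unfolding D_def using assms(1) k by (intro add_nonneg_pos) simp_all
  have c: "c = \<rho> / D * S"
    by (simp add: c_def D_def S_def)
  have norm: "l1_norm v = (\<Sum>t=1..k. \<bar>v $ i t\<bar>) + S"
    unfolding l1_norm_def S_def using sum_enum[OF enum, of k abs] k by simp
  have "D / \<rho> * \<bar>enum_entry v i k\<bar> \<le> S"
    using lower unfolding threshold_seq_inclusive[OF assms(1)] norm by (simp add: D_def mult.commute)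
  hence le: "\<bar>enum_entry v i k\<bar> \<le> c"
    using assms(1) D by (simp add: c field_simps)
  have "S < D / \<rho> * \<bar>enum_entry v i (Suc k)\<bar>"
    using upper unfolding Suc_eq_plus1[symmetric] threshold_seq_Suc norm
    by (simp add: D_def mult.commute)
  hence ge: "c \<le> \<bar>enum_entry v i (Suc k)\<bar>"
    using assms(1) D by (simp add: c field_simps)
  show "\<bar>v $ i t\<bar> \<le> c" if "t \<in> {1..k}"
    using enum_entry_abs_mono[OF enum, of t k] that k le by (simp add: enum_entry_def)
  show "c \<le> \<bar>v $ i t\<bar>" if "t \<in> {k+1..CARD('n)}"
    using enum_entry_abs_mono[OF enum, of "Suc k" t] that ge by (simp add: enum_entry_def)
qed

lemma sorted_level_is_fixed_point:
  fixes v :: "real ^ 'n"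
  assumes "\<rho> > 0" and enum: "abs_sorting_enum v i" and k: "k < CARD('n)"
    and "threshold_seq \<rho> v i k \<le> l1_norm v"
    and "l1_norm v < threshold_seq \<rho> v i (k + 1)"
  defines "c \<equiv> \<rho> / (\<rho> * (real CARD('n) - real k) + 1) * (\<Sum>l=k+1..CARD('n). \<bar>v $ i l\<bar>)"
  shows "c = \<rho> * (\<Sum>j\<in>UNIV. max (\<bar>v $ j\<bar> - c) 0)"
proof -
  note sep = sorted_level_separates[OF assms(1-5), folded c_def]
  define S where "S = (\<Sum>l=k+1..CARD('n). \<bar>v $ i l\<bar>)"
  have D: "\<rho> * (real CARD('n) - real k) + 1 > 0"
    using assms(1) k by (intro add_nonneg_pos) simp_all
  have "(\<Sum>j\<in>UNIV. max (\<bar>v $ j\<bar> - c) 0)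
        = (\<Sum>t=1..k. max (\<bar>v $ i t\<bar> - c) 0) + (\<Sum>t=k+1..CARD('n). max (\<bar>v $ i t\<bar> - c) 0)"
    using sum_enum[OF enum, of k "\<lambda>x. max (\<bar>x\<bar> - c) 0"] k by simp
  also have "(\<Sum>t=1..k. max (\<bar>v $ i t\<bar> - c) 0) = 0"
    using sep(1) by (intro sum.neutral ballI) simp
  also have "(\<Sum>t=k+1..CARD('n). max (\<bar>v $ i t\<bar> - c) 0) = (\<Sum>t=k+1..CARD('n). \<bar>v $ i t\<bar> - c)"
    using sep(2) by (intro sum.cong refl) simp
  also have "\<dots> = S - (real CARD('n) - real k) * c"
    using k by (simp add: S_def sum_subtractf of_nat_diff)
  finally have sum: "(\<Sum>j\<in>UNIV. max (\<bar>v $ j\<bar> - c) 0) = S - (real CARD('n) - real k) * c"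
    by simp
  have "c * (\<rho> * (real CARD('n) - real k) + 1) = \<rho> * S"
    using D by (simp add: c_def S_def)
  thus ?thesis
    unfolding sum by (simp add: algebra_simps)
qed

theorem lemma3:
  fixes \<rho> :: real and v :: "real ^ 'n"
  assumes "\<rho> > 0"
  shows "(\<exists>!z. is_l1sq_solution \<rho> v z) \<and>
    (v = 0 \<longrightarrow> (\<forall>z. is_l1sq_solution \<rho> v z \<longrightarrow> z = 0)) \<and>
    (v \<noteq> 0 \<longrightarrow> (\<forall>i. abs_sorting_enum v i \<longrightarrow>
       mono_on {0..CARD('n)} (threshold_seq \<rho> v i) \<and>
       l1_norm v < threshold_seq \<rho> v i CARD('n) \<and>
       (\<forall>k<CARD('n).
          threshold_seq \<rho> v i k \<le> l1_norm v \<and> l1_norm v < threshold_seq \<rho> v i (k + 1) \<longrightarrow>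
          (\<forall>z. is_l1sq_solution \<rho> v z \<longrightarrow>
             (\<forall>t\<in>{1..CARD('n)}.
                z $ i t =
                  (if t \<le> k then 0
                   else v $ i t - sgn (v $ i t) * \<rho> / (\<rho> * (real CARD('n) - real k) + 1)
                          * (\<Sum>l=k+1..CARD('n). \<bar>v $ i l\<bar>)))))))"
proof (intro conjI impI allI ballI)
  show "\<exists>!z. is_l1sq_solution \<rho> v z"
    using threshold_level_exists[OF assms, of v] is_l1sq_solution_iff_soft_threshold[OF assms]
    by metis
next
  fix z assume "v = 0" and "is_l1sq_solution \<rho> v z"
  thus "z = 0"
    using is_l1sq_solution_iff_soft_threshold[OF assms, of 0 v z]
    by (simp add: soft_threshold_vec_def soft_threshold_def vec_eq_iff)
next
  fix i assume "abs_sorting_enum v i"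
  thus "mono_on {0..CARD('n)} (threshold_seq \<rho> v i)"
    by (rule threshold_seq_mono[OF assms])
next
  fix i assume "v \<noteq> 0" and "abs_sorting_enum v i"
  thus "l1_norm v < threshold_seq \<rho> v i CARD('n)"
    by (intro l1_norm_less_last_threshold[OF assms])
next
  fix i k z t
  assume enum: "abs_sorting_enum v i" and k: "k < CARD('n)"
    and thresholds: "threshold_seq \<rho> v i k \<le> l1_norm v \<and> l1_norm v < threshold_seq \<rho> v i (k + 1)"
    and z: "is_l1sq_solution \<rho> v z" and t: "t \<in> {1..CARD('n)}"
  define c where "c = \<rho> / (\<rho> * (real CARD('n) - real k) + 1) * (\<Sum>l=k+1..CARD('n). \<bar>v $ i l\<bar>)"
  note hyps = assms enum k conjunct1[OF thresholds] conjunct2[OF thresholds]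
  have "z = soft_threshold_vec c v"
    using is_l1sq_solution_iff_soft_threshold[OF assms] z
      sorted_level_is_fixed_point[OF hyps, folded c_def] by blast
  hence zt: "z $ i t = soft_threshold c (v $ i t)"
    by (simp add: soft_threshold_vec_def)
  have "z $ i t = (if t \<le> k then 0 else v $ i t - sgn (v $ i t) * c)"
    using sorted_level_separates[OF hyps, folded c_def, of t] t
    by (auto simp: zt soft_threshold_below soft_threshold_above)
  thus "z $ i t = (if t \<le> k then 0
          else v $ i t - sgn (v $ i t) * \<rho> / (\<rho> * (real CARD('n) - real k) + 1)
                 * (\<Sum>l=k+1..CARD('n). \<bar>v $ i l\<bar>))"
    by (simp add: c_def)
qed

end
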